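(* There exists $N$ such that for every odd $n \ge N$ there exists a voting rule $\Phi : \{-1,1\}^n \to \{-1,1\}$ that is odd, monotone and unbiased, but not transitive-symmetric.
   Context: A voting rule on $n$ voters is a function $\Phi : \{-1,1\}^n \to \{-1,1\}$. It is odd if $\Phi(-x) = -\Phi(x)$ for all $x$, and monotone if $\Phi(x) \ge \Phi(x')$ whenever $x \ge x'$ coordinate-wise. A permutation $\sigma$ of $[n]$ acts on $\{-1,1\}^n$ by permuting coordinates, and on voting rules by $(\sigma\Phi)(x) = \Phi(\sigma^{-1}(x))$; $\mathrm{aut}(\Phi)$ is the group of permutations $\sigma$ with $\sigma\Phi = \Phi$. $\Phi$ is transitive-symmetric if for every $u, v \in [n]$ there is $\sigma \in \mathrm{aut}(\Phi)$ with $\sigma(u) = v$. For $x \in \{-1,1\}^n$ let $x^{\oplus i}$ be $x$ with its $i$-th coordinate negated. For a probability measure $q$ on $\{-1,1\}^n$, the influence of voter $i$ is $\mathbb{I}_i^q(\Phi) = \mathbb{P}_{x \sim q}[\Phi(x) \ne \Phi(x^{\oplus i})]$. $\Phi$ is unbiased if $\mathbb{I}_1^q(\Phi) = \cdots = \mathbb{I}_n^q(\Phi)$ for every i.i.d. measure $q = p^{\otimes n}$, where $p$ is a probability measure on $\{-1,1\}$. *)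

theory Defs
  imports "HOL-Probability.Probability" "HOL-Combinatorics.Permutations"
begin

text \<open>
  The cube \<open>{-1,1}\<^sup>n\<close> consists of extensional functions: a point takes values in \<open>{-1,1}\<close> on
  \<open>{1..n}\<close> and equals \<^term>\<open>undefined\<close> elsewhere, so equality of points is equality of their
  \<open>n\<close> coordinates.
\<close>

definition voters :: "nat \<Rightarrow> nat set" where
  "voters n = {1..n}"

definition cube :: "nat \<Rightarrow> (nat \<Rightarrow> int) set" where
  "cube n = voters n \<rightarrow>\<^sub>E {-1, 1}"

text \<open>The values of a voting rule outside the cube are irrelevant.\<close>

definition voting_rule :: "nat \<Rightarrow> ((nat \<Rightarrow> int) \<Rightarrow> int) \<Rightarrow> bool" where
  "voting_rule n \<Phi> \<longleftrightarrow> \<Phi> \<in> cube n \<rightarrow> {-1, 1}"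

definition neg_point :: "nat \<Rightarrow> (nat \<Rightarrow> int) \<Rightarrow> (nat \<Rightarrow> int)" where
  "neg_point n x = (\<lambda>i\<in>voters n. - x i)"

definition odd_rule :: "nat \<Rightarrow> ((nat \<Rightarrow> int) \<Rightarrow> int) \<Rightarrow> bool" where
  "odd_rule n \<Phi> \<longleftrightarrow> (\<forall>x\<in>cube n. \<Phi> (neg_point n x) = - \<Phi> x)"

definition monotone_rule :: "nat \<Rightarrow> ((nat \<Rightarrow> int) \<Rightarrow> int) \<Rightarrow> bool" where
  "monotone_rule n \<Phi> \<longleftrightarrow>
     (\<forall>x\<in>cube n. \<forall>x'\<in>cube n. (\<forall>i\<in>voters n. x i \<ge> x' i) \<longrightarrow> \<Phi> x \<ge> \<Phi> x')"

text \<open>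
  The left action on points moves the value at coordinate \<open>i\<close> to coordinate \<open>\<sigma> i\<close>. Permutations
  of \<open>{1..n}\<close> are extended by the identity, so the action preserves the cube.
\<close>

definition perm_point :: "(nat \<Rightarrow> nat) \<Rightarrow> (nat \<Rightarrow> int) \<Rightarrow> (nat \<Rightarrow> int)" where
  "perm_point \<sigma> x = (\<lambda>i. x (inv \<sigma> i))"

definition perm_rule :: "(nat \<Rightarrow> nat) \<Rightarrow> ((nat \<Rightarrow> int) \<Rightarrow> int) \<Rightarrow> ((nat \<Rightarrow> int) \<Rightarrow> int)" where
  "perm_rule \<sigma> \<Phi> = (\<lambda>x. \<Phi> (perm_point (inv \<sigma>) x))"

definition aut :: "nat \<Rightarrow> ((nat \<Rightarrow> int) \<Rightarrow> int) \<Rightarrow> (nat \<Rightarrow> nat) set" where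
  "aut n \<Phi> = {\<sigma>. \<sigma> permutes voters n \<and> (\<forall>x\<in>cube n. perm_rule \<sigma> \<Phi> x = \<Phi> x)}"

definition transitive_symmetric :: "nat \<Rightarrow> ((nat \<Rightarrow> int) \<Rightarrow> int) \<Rightarrow> bool" where
  "transitive_symmetric n \<Phi> \<longleftrightarrow>
     (\<forall>u\<in>voters n. \<forall>v\<in>voters n. \<exists>\<sigma>\<in>aut n \<Phi>. \<sigma> u = v)"

definition flip :: "nat \<Rightarrow> (nat \<Rightarrow> int) \<Rightarrow> (nat \<Rightarrow> int)" where
  "flip i x = x(i := - x i)"

text \<open>
  A probability measure on \<open>{-1,1}\<close> or on the cube is represented by a probability mass function
  supported there.
\<close>

definition influence ::
    "(nat \<Rightarrow> int) pmf \<Rightarrow> ((nat \<Rightarrow> int) \<Rightarrow> int) \<Rightarrow> nat \<Rightarrow> real" where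
  "influence q \<Phi> i = measure_pmf.prob q {x. \<Phi> x \<noteq> \<Phi> (flip i x)}"

definition iid :: "nat \<Rightarrow> int pmf \<Rightarrow> (nat \<Rightarrow> int) pmf" where
  "iid n p = Pi_pmf (voters n) undefined (\<lambda>_. p)"

definition unbiased :: "nat \<Rightarrow> ((nat \<Rightarrow> int) \<Rightarrow> int) \<Rightarrow> bool" where
  "unbiased n \<Phi> \<longleftrightarrow>
     (\<forall>p. set_pmf p \<subseteq> {-1, 1} \<longrightarrow>
        (\<forall>i\<in>voters n. \<forall>j\<in>voters n. influence (iid n p) \<Phi> i = influence (iid n p) \<Phi> j))"

lemma neg_point_in_cube: "x \<in> cube n \<Longrightarrow> neg_point n x \<in> cube n"
  by (auto simp: cube_def neg_point_def PiE_iff)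

lemma flip_in_cube: "x \<in> cube n \<Longrightarrow> i \<in> voters n \<Longrightarrow> flip i x \<in> cube n"
  by (auto simp: cube_def flip_def PiE_iff extensional_def)

lemma perm_point_in_cube:
  assumes "\<sigma> permutes voters n" "x \<in> cube n"
  shows "perm_point \<sigma> x \<in> cube n"
  using assms permutes_in_image[OF permutes_inv[OF assms(1)]]
  by (auto simp: cube_def perm_point_def PiE_iff extensional_def)

lemma set_pmf_iid:
  assumes "set_pmf p \<subseteq> {-1, 1}"
  shows "set_pmf (iid n p) \<subseteq> cube n"
  using assms by (auto simp: iid_def cube_def voters_def set_Pi_pmf PiE_dflt_def PiE_iff extensional_def)

end

theory Submission
  imports Defs
begin

text \<open>
  Write \<open>n = 2m + 1\<close> and let \<open>\<F>\<close> be an intersecting family of \<open>m\<close>-sets of voters. Modify the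
  majority rule by letting the members of \<open>\<F>\<close> win and their complements lose. The result is odd,
  it is monotone because \<open>\<F>\<close> is intersecting, and it is unbiased if every voter lies in equally
  many members of \<open>\<F>\<close>, since then on each level the winning coalitions form a regular family and
  the number of pivotal coalitions of a monotone rule is determined by the degrees on the levels.

  For \<open>\<F>\<close> take a set \<open>X\<close> of four voters, sets \<open>{x} \<union> B\<close> with \<open>x \<in> X\<close> and \<open>B\<close> in a family
  \<open>\<G>\<close>, and sets \<open>X \<union> C\<close> with \<open>C\<close> in a family \<open>\<H>\<close>, where \<open>\<G>\<close> and \<open>\<H>\<close> are regular
  families on the complement \<open>Y\<close> of \<open>X\<close>. All pairs of voters between \<open>X\<close> and \<open>Y\<close> lie in the
  same number of members of \<open>\<F>\<close>, different from the number for pairs inside \<open>X\<close>. Hence a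
  transitive automorphism group would partition the voters into translates of \<open>X\<close>, although
  \<open>n\<close> is odd.
\<close>

section \<open>Regular families of sets\<close>

definition fdeg :: "'a set set \<Rightarrow> 'a \<Rightarrow> nat" where
  "fdeg \<F> v = card {A\<in>\<F>. v \<in> A}"

definition codeg :: "'a set set \<Rightarrow> 'a \<Rightarrow> 'a \<Rightarrow> nat" where
  "codeg \<F> u v = card {A\<in>\<F>. u \<in> A \<and> v \<in> A}"

text \<open>Double counting of the incidences between points and members.\<close>

lemma sum_fdeg:
  assumes "finite Y" "finite \<F>" "\<And>A. A \<in> \<F> \<Longrightarrow> A \<subseteq> Y \<and> card A = k"
  shows "(\<Sum>v\<in>Y. fdeg \<F> v) = k * card \<F>"
proof -
  have "(\<Sum>v\<in>Y. fdeg \<F> v) = (\<Sum>v\<in>Y. \<Sum>A\<in>\<F>. if v \<in> A then 1 else 0)"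
    using assms(2) by (simp add: fdeg_def sum.If_cases Int_def)
  also have "\<dots> = (\<Sum>A\<in>\<F>. \<Sum>v\<in>Y. if v \<in> A then 1 else 0)"
    by (rule sum.swap)
  also have "\<dots> = (\<Sum>A\<in>\<F>. k)"
  proof (rule sum.cong[OF refl])
    fix A assume "A \<in> \<F>"
    then have "A \<subseteq> Y" "card A = k" using assms(3) by auto
    then show "(\<Sum>v\<in>Y. if v \<in> A then 1 else 0) = k"
      using assms(1) by (simp add: sum.If_cases Int_absorb1)
  qed
  finally show ?thesis by simp
qed

text \<open>Exchanging \<open>u\<close> for \<open>v\<close> is injective on the members that
  contain \<open>u\<close> but not \<open>v\<close>. If the result were always a member again, at
  least as many members would contain \<open>v\<close> but not \<open>u\<close>. Members containing
  both count equally for both degrees.\<close>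

lemma exists_switch:
  assumes "finite \<F>" "fdeg \<F> v < fdeg \<F> u"
  shows "\<exists>A\<in>\<F>. u \<in> A \<and> v \<notin> A \<and> insert v (A - {u}) \<notin> \<F>"
proof (rule ccontr)
  assume "\<not> ?thesis"
  then have *: "insert v (A - {u}) \<in> \<F>" if "A \<in> \<F>" "u \<in> A" "v \<notin> A" for A
    using that by blast
  have uv: "u \<noteq> v" using assms(2) by auto
  define U where "U = {A\<in>\<F>. u \<in> A \<and> v \<notin> A}"
  define V where "V = {A\<in>\<F>. v \<in> A \<and> u \<notin> A}"
  define C where "C = {A\<in>\<F>. u \<in> A \<and> v \<in> A}"
  have "card U \<le> card V"
  proof (rule card_inj_on_le)
    show "inj_on (\<lambda>A. insert v (A - {u})) U"
      by (rule inj_on_inverseI[where g = "\<lambda>B. insert u (B - {v})"]) (auto simp: U_def)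
    show "(\<lambda>A. insert v (A - {u})) ` U \<subseteq> V" using * uv by (auto simp: U_def V_def)
    show "finite V" using assms(1) by (simp add: V_def)
  qed
  moreover have "fdeg \<F> u = card U + card C"
    unfolding fdeg_def U_def C_def using assms(1)
    by (subst card_Un_disjoint[symmetric]) (auto intro!: arg_cong[where f = card])
  moreover have "fdeg \<F> v = card V + card C"
    unfolding fdeg_def V_def C_def using assms(1)
    by (subst card_Un_disjoint[symmetric]) (auto intro!: arg_cong[where f = card])
  ultimately show False using assms(2) by simp
qed

text \<open>
  A family minimising the sum of the squared degrees is almost regular: otherwise replacing an
  element of large degree by one of small degree in a suitable member decreases that sum.
\<close>

lemma exists_almost_regular_family:
  assumes "finite Y" "s \<le> card Y choose k"
  obtains \<F> where "\<F> \<subseteq> {A. A \<subseteq> Y \<and> card A = k}" "card \<F> = s"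
    "\<And>u v. u \<in> Y \<Longrightarrow> v \<in> Y \<Longrightarrow> fdeg \<F> u \<le> fdeg \<F> v + 1"
proof -
  define K where "K = {A. A \<subseteq> Y \<and> card A = k}"
  have finK: "finite K" unfolding K_def using assms(1) by simp
  have "s \<le> card K" using assms by (simp add: K_def n_subsets)
  then obtain \<F>0 where "\<F>0 \<subseteq> K \<and> card \<F>0 = s"
    using obtain_subset_with_card_n by metis
  then obtain \<F> where F: "\<F> \<subseteq> K \<and> card \<F> = s"
    and least: "\<And>\<G>. \<G> \<subseteq> K \<and> card \<G> = s \<Longrightarrow>
        (\<Sum>v\<in>Y. (fdeg \<F> v)\<^sup>2) \<le> (\<Sum>v\<in>Y. (fdeg \<G> v)\<^sup>2)"
    using ex_has_least_nat[of "\<lambda>\<F>. \<F> \<subseteq> K \<and> card \<F> = s" _ "\<lambda>\<F>. \<Sum>v\<in>Y. (fdeg \<F> v)\<^sup>2"]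
    by blast
  have finF: "finite \<F>" using F finK finite_subset by blast
  have "fdeg \<F> u \<le> fdeg \<F> v + 1" if uv: "u \<in> Y" "v \<in> Y" for u v
  proof (rule ccontr)
    assume "\<not> ?thesis"
    then have gap: "fdeg \<F> v + 2 \<le> fdeg \<F> u" by simp
    then have "fdeg \<F> v < fdeg \<F> u" by simp
    then obtain A where A: "A \<in> \<F>" "u \<in> A" "v \<notin> A" "insert v (A - {u}) \<notin> \<F>"
      using exists_switch[OF finF] by blast
    define B where "B = insert v (A - {u})"
    define \<G> where "\<G> = insert B (\<F> - {A})"
    have neq: "u \<noteq> v" using A by auto
    have AY: "A \<subseteq> Y" "card A = k" using A(1) F by (auto simp: K_def)
    have finA: "finite A" using finite_subset[OF AY(1) assms(1)] .
    have "card A > 0" using A(2) finA card_gt_0_iff by blast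
    then have "card B = k" using A AY finA by (simp add: B_def)
    then have "\<G> \<subseteq> K" using F AY uv by (auto simp: \<G>_def B_def K_def)
    moreover have "card \<F> > 0" using A(1) finF card_gt_0_iff by blast
    then have "card \<G> = s" using F finF A by (simp add: \<G>_def B_def)
    ultimately have le: "(\<Sum>v\<in>Y. (fdeg \<F> v)\<^sup>2) \<le> (\<Sum>v\<in>Y. (fdeg \<G> v)\<^sup>2)"
      using least by blast
    have same: "fdeg \<G> w = fdeg \<F> w" if "w \<noteq> u" "w \<noteq> v" for w
    proof (cases "w \<in> A")
      case True
      then have "{A\<in>\<G>. w \<in> A} = insert B ({A\<in>\<F>. w \<in> A} - {A})"
        using that by (auto simp: \<G>_def B_def)
      moreover have "card {A\<in>\<F>. w \<in> A} > 0"
        using True A(1) finF by (auto simp: card_gt_0_iff)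
      ultimately show ?thesis using A True finF by (simp add: fdeg_def B_def)
    next
      case False
      then have "{A\<in>\<G>. w \<in> A} = {A\<in>\<F>. w \<in> A}"
        using that by (auto simp: \<G>_def B_def)
      then show ?thesis by (simp add: fdeg_def)
    qed
    have "{A\<in>\<G>. u \<in> A} = {A\<in>\<F>. u \<in> A} - {A}"
      using neq by (auto simp: \<G>_def B_def)
    then have du: "fdeg \<G> u = fdeg \<F> u - 1" using A finF by (simp add: fdeg_def)
    have "{A\<in>\<G>. v \<in> A} = insert B {A\<in>\<F>. v \<in> A}"
      using A by (auto simp: \<G>_def B_def)
    then have dv: "fdeg \<G> v = fdeg \<F> v + 1" using A finF by (simp add: fdeg_def B_def)
    have split: "(\<Sum>w\<in>Y. g w) = g u + g v + (\<Sum>w\<in>Y - {u} - {v}. g w)" for g :: "'a \<Rightarrow> nat"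
      using uv assms(1) neq by (simp add: sum.remove[of Y u] sum.remove[of "Y - {u}" v])
    have "(\<Sum>w\<in>Y - {u} - {v}. (fdeg \<G> w)\<^sup>2) = (\<Sum>w\<in>Y - {u} - {v}. (fdeg \<F> w)\<^sup>2)"
      by (rule sum.cong) (auto simp: same)
    \<comment> \<open>The exchange changes the sum of squares only at \<open>u\<close> and
      \<open>v\<close>. If the degrees there differ by \<open>2 + d\<close>, the sum drops by
      \<open>2 * d + 2\<close>, against minimality.\<close>
    then have "(fdeg \<F> u)\<^sup>2 + (fdeg \<F> v)\<^sup>2 \<le> (fdeg \<F> u - 1)\<^sup>2 + (fdeg \<F> v + 1)\<^sup>2"
      using le by (simp add: split du dv)
    moreover obtain d where "fdeg \<F> u = fdeg \<F> v + 2 + d" using gap le_Suc_ex by blast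
    ultimately show False by (simp add: power2_eq_square algebra_simps)
  qed
  then show thesis using that F unfolding K_def by blast
qed

text \<open>With \<open>t * card Y\<close> members of size \<open>k\<close> the average degree is
  the integer \<open>k * t\<close>. Degrees that pairwise differ by at most one and have an integer
  average all equal it.\<close>

lemma exists_regular_family:
  assumes "finite Y" "t * card Y \<le> card Y choose k"
  obtains \<F> where "\<F> \<subseteq> {A. A \<subseteq> Y \<and> card A = k}" "card \<F> = t * card Y"
    "\<And>v. v \<in> Y \<Longrightarrow> fdeg \<F> v = k * t"
proof -
  obtain \<F> where F: "\<F> \<subseteq> {A. A \<subseteq> Y \<and> card A = k}" "card \<F> = t * card Y"
    and close: "\<And>u v. u \<in> Y \<Longrightarrow> v \<in> Y \<Longrightarrow> fdeg \<F> u \<le> fdeg \<F> v + 1"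
    using exists_almost_regular_family[OF assms] by blast
  have finF: "finite \<F>" using finite_subset[OF F(1)] assms(1) by simp
  have sum: "(\<Sum>v\<in>Y. fdeg \<F> v) = (\<Sum>v\<in>Y. k * t)"
    by (subst sum_fdeg[OF assms(1) finF, of k]) (use F in auto)
  have "fdeg \<F> v = k * t" if v: "v \<in> Y" for v
  proof (rule linorder_cases)
    assume lt: "fdeg \<F> v < k * t"
    have "fdeg \<F> u \<le> k * t" if "u \<in> Y" for u using close[OF that v] lt by linarith
    then have "(\<Sum>v\<in>Y. fdeg \<F> v) < (\<Sum>v\<in>Y. k * t)"
      using lt v assms(1) by (intro sum_strict_mono_ex1) auto
    with sum show ?thesis by simp
  next
    assume gt: "k * t < fdeg \<F> v"
    have "k * t \<le> fdeg \<F> u" if "u \<in> Y" for u using close[OF v that] gt by linarith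
    then have "(\<Sum>v\<in>Y. k * t) < (\<Sum>v\<in>Y. fdeg \<F> v)"
      using gt v assms(1) by (intro sum_strict_mono_ex1) auto
    with sum show ?thesis by simp
  qed
  then show thesis using that F by blast
qed

section \<open>Voting rules given by their winning coalitions\<close>

definition ups :: "nat \<Rightarrow> (nat \<Rightarrow> int) \<Rightarrow> nat set" where
  "ups n x = {i\<in>voters n. x i = 1}"

definition point_of :: "nat \<Rightarrow> nat set \<Rightarrow> (nat \<Rightarrow> int)" where
  "point_of n A = (\<lambda>i\<in>voters n. if i \<in> A then 1 else -1)"

definition coalition_rule :: "nat \<Rightarrow> nat set set \<Rightarrow> (nat \<Rightarrow> int) \<Rightarrow> int" where
  "coalition_rule n \<W> x = (if ups n x \<in> \<W> then 1 else -1)"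

lemma finite_voters [simp]: "finite (voters n)"
  by (simp add: voters_def)

lemma card_voters [simp]: "card (voters n) = n"
  by (simp add: voters_def)

lemma finite_cube: "finite (cube n)"
  unfolding cube_def by (intro finite_PiE) auto

lemma ups_subset: "ups n x \<subseteq> voters n"
  by (auto simp: ups_def)

lemma cube_cases: "x \<in> cube n \<Longrightarrow> i \<in> voters n \<Longrightarrow> x i = 1 \<or> x i = -1"
  by (auto simp: cube_def PiE_iff)

lemma point_of_in_cube: "point_of n A \<in> cube n"
  by (auto simp: point_of_def cube_def)

lemma ups_point_of: "A \<subseteq> voters n \<Longrightarrow> ups n (point_of n A) = A"
  by (auto simp: ups_def point_of_def split: if_splits)

lemma point_of_ups: "x \<in> cube n \<Longrightarrow> point_of n (ups n x) = x"
  by (rule ext) (auto simp: ups_def point_of_def cube_def PiE_iff extensional_def)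

lemma ups_neg_point: "x \<in> cube n \<Longrightarrow> ups n (neg_point n x) = voters n - ups n x"
  using cube_cases by (fastforce simp: ups_def neg_point_def)

text \<open>Symmetric difference with \<open>{i}\<close>, the counterpart of \<open>flip i\<close>
  on coalitions.\<close>

definition toggle :: "'a \<Rightarrow> 'a set \<Rightarrow> 'a set" where
  "toggle i A = (if i \<in> A then A - {i} else insert i A)"

lemma ups_flip: "x \<in> cube n \<Longrightarrow> i \<in> voters n \<Longrightarrow> ups n (flip i x) = toggle i (ups n x)"
  using cube_cases[of x n i] by (auto simp: ups_def flip_def toggle_def split: if_splits)

lemma coalition_rule_voting: "voting_rule n (coalition_rule n \<W>)"
  by (simp add: voting_rule_def coalition_rule_def)

lemma coalition_rule_odd:
  assumes "\<And>A. A \<subseteq> voters n \<Longrightarrow> voters n - A \<in> \<W> \<longleftrightarrow> A \<notin> \<W>"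
  shows "odd_rule n (coalition_rule n \<W>)"
  using assms ups_subset by (auto simp: odd_rule_def coalition_rule_def ups_neg_point)

lemma coalition_rule_monotone:
  assumes "\<And>A B. A \<in> \<W> \<Longrightarrow> A \<subseteq> B \<Longrightarrow> B \<subseteq> voters n \<Longrightarrow> B \<in> \<W>"
  shows "monotone_rule n (coalition_rule n \<W>)"
  unfolding monotone_rule_def
proof (intro ballI impI)
  fix x x' assume x: "x \<in> cube n" "x' \<in> cube n" and le: "\<forall>i\<in>voters n. x i \<ge> x' i"
  have "ups n x' \<subseteq> ups n x" using le cube_cases[OF x(1)] by (fastforce simp: ups_def)
  then show "coalition_rule n \<W> x' \<le> coalition_rule n \<W> x"
    using assms ups_subset by (auto simp: coalition_rule_def)
qed

text \<open>Invariance is evaluated at the point of the image coalition, because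
  \<open>perm_rule\<close> pulls points back along \<sigma> and so turns that point into the point
  of \<open>A\<close>.\<close>

lemma aut_coalition_rule:
  assumes \<sigma>: "\<sigma> \<in> aut n (coalition_rule n \<W>)" and A: "A \<subseteq> voters n"
  shows "\<sigma> ` A \<in> \<W> \<longleftrightarrow> A \<in> \<W>"
proof -
  have perm: "\<sigma> permutes voters n" using \<sigma> by (simp add: aut_def)
  have B: "\<sigma> ` A \<subseteq> voters n" using A permutes_image[OF perm] by blast
  have "perm_point (inv \<sigma>) (point_of n (\<sigma> ` A)) = point_of n A"
  proof
    fix i
    have "inv (inv \<sigma>) i = \<sigma> i" using permutes_inv_inv[OF perm] by simp
    then show "perm_point (inv \<sigma>) (point_of n (\<sigma> ` A)) i = point_of n A i"
      using permutes_in_image[OF perm] permutes_inj[OF perm]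
      by (simp add: perm_point_def point_of_def inj_image_mem_iff restrict_def)
  qed
  moreover have "perm_rule \<sigma> (coalition_rule n \<W>) (point_of n (\<sigma> ` A)) =
      coalition_rule n \<W> (point_of n (\<sigma> ` A))"
    using \<sigma> point_of_in_cube by (simp add: aut_def)
  ultimately show ?thesis
    by (simp add: perm_rule_def coalition_rule_def ups_point_of A B split: if_splits)
qed

section \<open>Influences\<close>

lemma pmf_iid:
  assumes "x \<in> cube n"
  shows "pmf (iid n p) x = pmf p 1 ^ card (ups n x) * pmf p (-1) ^ (n - card (ups n x))"
proof -
  have "pmf (iid n p) x = (\<Prod>v\<in>voters n. pmf p (x v))"
    using assms unfolding iid_def by (subst pmf_Pi') (auto simp: cube_def PiE_iff extensional_def)
  also have "\<dots> = (\<Prod>v\<in>voters n. if x v = 1 then pmf p 1 else pmf p (-1))"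
    using cube_cases[OF assms] by (intro prod.cong) force+
  also have "\<dots> = pmf p 1 ^ card (ups n x) * pmf p (-1) ^ card (voters n - ups n x)"
    by (subst prod.If_cases)
       (auto simp: ups_def intro!: arg_cong[where f = card] arg_cong2[where f = "(*)"]
          arg_cong2[where f = "(^)"])
  also have "card (voters n - ups n x) = n - card (ups n x)"
    using ups_subset[of n x] by (subst card_Diff_subset) (auto intro: finite_subset)
  finally show ?thesis .
qed

text \<open>The weight of a point depends only on the size of its coalition. Equality of influences
  for every \<open>p\<close> thus follows once the pivotal coalitions of each size are equally many
  for all voters.\<close>

lemma influence_coalition_rule:
  assumes p: "set_pmf p \<subseteq> {-1, 1}" and i: "i \<in> voters n"
  shows "influence (iid n p) (coalition_rule n \<W>) i =
    (\<Sum>k\<le>n. real (card {A. A \<subseteq> voters n \<and> card A = k \<and> (A \<in> \<W>) \<noteq> (toggle i A \<in> \<W>)}) *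
      (pmf p 1 ^ k * pmf p (-1) ^ (n - k)))"
proof -
  let ?E = "{x. coalition_rule n \<W> x \<noteq> coalition_rule n \<W> (flip i x)}"
  let ?w = "\<lambda>k. pmf p 1 ^ k * pmf p (-1) ^ (n - k)"
  define P where "P = {A. A \<subseteq> voters n \<and> (A \<in> \<W>) \<noteq> (toggle i A \<in> \<W>)}"
  have finP: "finite P" by (simp add: P_def)
  \<comment> \<open>The measure is supported on the cube, so the event can be cut down to a finite
    set on which \<open>ups n\<close> is injective.\<close>
  have "influence (iid n p) (coalition_rule n \<W>) i = measure_pmf.prob (iid n p) (?E \<inter> cube n)"
    unfolding influence_def
    by (rule measure_pmf.finite_measure_eq_AE)
       (use set_pmf_iid[OF p] in \<open>auto simp: AE_measure_pmf_iff\<close>)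
  also have "\<dots> = (\<Sum>x\<in>?E \<inter> cube n. pmf (iid n p) x)"
    by (simp add: measure_measure_pmf_finite finite_cube)
  also have "\<dots> = (\<Sum>x\<in>?E \<inter> cube n. ?w (card (ups n x)))"
    by (intro sum.cong) (auto simp: pmf_iid)
  also have "\<dots> = (\<Sum>A\<in>P. ?w (card A))"
  proof (rule sum.reindex_bij_witness[where i = "point_of n" and j = "ups n"])
    fix A assume "A \<in> P"
    then show "point_of n A \<in> ?E \<inter> cube n"
      using i by (simp add: P_def coalition_rule_def ups_flip ups_point_of point_of_in_cube)
  next
    fix x assume "x \<in> ?E \<inter> cube n"
    then show "ups n x \<in> P" using i ups_subset
      by (auto simp: P_def coalition_rule_def ups_flip split: if_splits)
  qed (auto simp: P_def point_of_ups ups_point_of)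
  also have "\<dots> = (\<Sum>k\<le>n. \<Sum>A\<in>{A\<in>P. card A = k}. ?w (card A))"
    by (rule sum.group[symmetric])
       (use card_mono[OF finite_voters] in \<open>auto simp: P_def\<close>)
  also have "\<dots> = (\<Sum>k\<le>n. real (card {A\<in>P. card A = k}) * ?w k)"
    by (intro sum.cong) auto
  finally show ?thesis
    by (simp add: P_def conj_ac cong: conj_cong)
qed

definition regular_family :: "'a set \<Rightarrow> 'a set set \<Rightarrow> bool" where
  "regular_family V \<F> \<longleftrightarrow> (\<forall>i\<in>V. \<forall>j\<in>V. fdeg \<F> i = fdeg \<F> j)"

definition level :: "'a set set \<Rightarrow> nat \<Rightarrow> 'a set set" where
  "level \<W> k = {A\<in>\<W>. card A = k}"

text \<open>By upward closure, deleting \<open>i\<close> maps the winning sets of size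
  \<open>Suc k\<close> that still win without \<open>i\<close> bijectively to the winning
  \<open>k\<close>-sets avoiding \<open>i\<close>. The count therefore depends on \<open>i\<close>
  only through degrees.\<close>

lemma card_pivotal_down:
  assumes V: "finite V" and sub: "\<And>A. A \<in> \<W> \<Longrightarrow> A \<subseteq> V" and i: "i \<in> V"
    and up: "\<And>A B. A \<in> \<W> \<Longrightarrow> A \<subseteq> B \<Longrightarrow> B \<subseteq> V \<Longrightarrow> B \<in> \<W>"
  shows "int (card {A\<in>level \<W> (Suc k). i \<in> A \<and> A - {i} \<notin> \<W>}) =
    int (fdeg (level \<W> (Suc k)) i) + int (fdeg (level \<W> k) i) - int (card (level \<W> k))"
proof -
  have finW: "finite \<W>" using sub V by (meson Pow_iff finite_Pow_iff finite_subset subsetI)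
  let ?D = "{A\<in>level \<W> (Suc k). i \<in> A}"
  let ?N = "{A\<in>level \<W> (Suc k). i \<in> A \<and> A - {i} \<notin> \<W>}"
  let ?C = "{A\<in>level \<W> (Suc k). i \<in> A \<and> A - {i} \<in> \<W>}"
  let ?T = "{B\<in>level \<W> k. i \<notin> B}"
  have fin: "finite (level \<W> l)" for l using finW by (simp add: level_def)
  have "card ?D = card ?N + card ?C"
    by (subst card_Un_disjoint[symmetric]) (auto simp: fin intro!: arg_cong[where f = card])
  moreover have "card ?C = card ?T"
  proof (rule bij_betw_same_card[where f = "\<lambda>A. A - {i}"],
      rule bij_betw_byWitness[where f' = "insert i"])
    show "insert i ` ?T \<subseteq> ?C"
    proof (rule image_subsetI)
      fix B assume "B \<in> ?T"
      then have B: "B \<in> level \<W> k" "i \<notin> B" by auto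
      then have "B \<in> \<W>" "B \<subseteq> V" "card B = k" using sub by (auto simp: level_def)
      then show "insert i B \<in> ?C"
        using B(2) up[of B "insert i B"] i V finite_subset[of B V] by (auto simp: level_def)
    qed
  qed (auto simp: level_def)
  moreover have "card (level \<W> k) = card ?T + fdeg (level \<W> k) i"
    unfolding fdeg_def
    by (subst card_Un_disjoint[symmetric]) (auto simp: fin intro!: arg_cong[where f = card])
  ultimately show ?thesis by (simp add: fdeg_def)
qed

text \<open>A pivotal coalition contains \<open>i\<close> and loses without it, or omits
  \<open>i\<close> and wins with it; upward closure excludes the opposite changes. Adding
  \<open>i\<close> moves the second kind up one level.\<close>

lemma card_pivotal:
  assumes V: "finite V" and sub: "\<And>A. A \<in> \<W> \<Longrightarrow> A \<subseteq> V" and i: "i \<in> V"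
    and up: "\<And>A B. A \<in> \<W> \<Longrightarrow> A \<subseteq> B \<Longrightarrow> B \<subseteq> V \<Longrightarrow> B \<in> \<W>"
  shows "card {A. A \<subseteq> V \<and> card A = k \<and> (A \<in> \<W>) \<noteq> (toggle i A \<in> \<W>)} =
    card {A\<in>level \<W> k. i \<in> A \<and> A - {i} \<notin> \<W>} +
    card {A\<in>level \<W> (Suc k). i \<in> A \<and> A - {i} \<notin> \<W>}"
proof -
  let ?P = "{A. A \<subseteq> V \<and> card A = k \<and> (A \<in> \<W>) \<noteq> (toggle i A \<in> \<W>)}"
  let ?N = "\<lambda>k. {A\<in>level \<W> k. i \<in> A \<and> A - {i} \<notin> \<W>}"
  have finP: "finite ?P" using V by simp
  have "{A\<in>?P. i \<in> A} = ?N k"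
    using sub up[of "_ - {i}"] by (auto simp: level_def toggle_def)
  moreover have "card {A\<in>?P. i \<notin> A} = card (?N (Suc k))"
  proof (rule bij_betw_same_card[where f = "insert i"],
      rule bij_betw_byWitness[where f' = "\<lambda>A. A - {i}"])
    show "insert i ` {A\<in>?P. i \<notin> A} \<subseteq> ?N (Suc k)"
    proof (rule image_subsetI)
      fix A assume "A \<in> {A\<in>?P. i \<notin> A}"
      then have A: "A \<subseteq> V" "i \<notin> A" "k = card A" "(A \<in> \<W>) \<noteq> (toggle i A \<in> \<W>)" by auto
      then have *: "A \<notin> \<W>" "insert i A \<in> \<W>"
        using up[of A "insert i A"] i by (auto simp: toggle_def)
      then show "insert i A \<in> ?N (Suc k)"
        using A V finite_subset[of A V] by (simp add: level_def)
    qed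
    show "(\<lambda>A. A - {i}) ` ?N (Suc k) \<subseteq> {A\<in>?P. i \<notin> A}"
      using sub by (auto simp: level_def toggle_def insert_absorb)
  qed auto
  moreover have "card ?P = card {A\<in>?P. i \<in> A} + card {A\<in>?P. i \<notin> A}"
    using finP
    by (subst card_Un_disjoint[symmetric])
       (auto intro!: arg_cong[where f = card] intro: finite_subset[OF _ finP])
  ultimately show ?thesis by simp
qed

lemma coalition_rule_unbiased:
  assumes sub: "\<And>A. A \<in> \<W> \<Longrightarrow> A \<subseteq> voters n"
    and up: "\<And>A B. A \<in> \<W> \<Longrightarrow> A \<subseteq> B \<Longrightarrow> B \<subseteq> voters n \<Longrightarrow> B \<in> \<W>"
    and reg: "\<And>k. regular_family (voters n) (level \<W> k)"
  shows "unbiased n (coalition_rule n \<W>)"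
  unfolding unbiased_def
proof (intro allI impI ballI)
  fix p :: "int pmf" and i j
  assume p: "set_pmf p \<subseteq> {-1, 1}" and ij: "i \<in> voters n" "j \<in> voters n"
  have deg: "fdeg (level \<W> k) i = fdeg (level \<W> k) j" for k
    using reg[of k] ij unfolding regular_family_def by blast
  have down: "card {A\<in>level \<W> k. i \<in> A \<and> A - {i} \<notin> \<W>} =
      card {A\<in>level \<W> k. j \<in> A \<and> A - {j} \<notin> \<W>}" for k
  proof (cases k)
    \<comment> \<open>\<open>card_pivotal_down\<close> speaks of successor levels only. At level 0
      both sets are empty, as the empty coalition contains no voter.\<close>
    case 0
    have "A = {}" if "A \<in> level \<W> 0" for A
      using that finite_subset[OF sub finite_voters, of A] by (simp add: level_def)
    then have "{A\<in>level \<W> k. l \<in> A \<and> A - {l} \<notin> \<W>} = {}" for l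
      using 0 by blast
    then show ?thesis by (simp only:)
  next
    case (Suc k')
    have "int (card {A\<in>level \<W> k. i \<in> A \<and> A - {i} \<notin> \<W>}) =
        int (card {A\<in>level \<W> k. j \<in> A \<and> A - {j} \<notin> \<W>})"
      unfolding Suc by (simp only: card_pivotal_down[OF finite_voters sub ij(1) up]
          card_pivotal_down[OF finite_voters sub ij(2) up] deg)
    then show ?thesis by simp
  qed
  show "influence (iid n p) (coalition_rule n \<W>) i = influence (iid n p) (coalition_rule n \<W>) j"
    by (simp only: influence_coalition_rule[OF p ij(1)] influence_coalition_rule[OF p ij(2)]
        card_pivotal[OF finite_voters sub ij(1) up] card_pivotal[OF finite_voters sub ij(2) up] down)
qed

section \<open>Perturbing the majority rule in its two middle levels\<close>

definition perturbed_majority :: "nat \<Rightarrow> nat set set \<Rightarrow> nat set set" where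
  "perturbed_majority m \<F> = {A. A \<subseteq> voters (2 * m + 1) \<and>
     (card A \<ge> m + 2 \<or> card A = m + 1 \<and> voters (2 * m + 1) - A \<notin> \<F> \<or> A \<in> \<F>)}"

lemma fdeg_all_subsets:
  assumes "finite V" "i \<in> V"
  shows "fdeg {A. A \<subseteq> V \<and> card A = Suc k} i = (card V - 1) choose k"
proof -
  have "{A\<in>{A. A \<subseteq> V \<and> card A = Suc k}. i \<in> A} = insert i ` {B. B \<subseteq> V - {i} \<and> card B = k}"
  proof (intro equalityI subsetI)
    fix A assume "A \<in> {A\<in>{A. A \<subseteq> V \<and> card A = Suc k}. i \<in> A}"
    then have "A - {i} \<in> {B. B \<subseteq> V - {i} \<and> card B = k}" "A = insert i (A - {i})" by auto
    then show "A \<in> insert i ` {B. B \<subseteq> V - {i} \<and> card B = k}" by blast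
  next
    fix A assume "A \<in> insert i ` {B. B \<subseteq> V - {i} \<and> card B = k}"
    then obtain B where B: "A = insert i B" "B \<subseteq> V - {i}" "card B = k" by blast
    have "finite B" using B(2) assms(1) by (meson finite_Diff finite_subset)
    then show "A \<in> {A\<in>{A. A \<subseteq> V \<and> card A = Suc k}. i \<in> A}"
      using B assms(2) by (auto simp: card_insert_if)
  qed
  moreover have "inj_on (insert i) {B. B \<subseteq> V - {i} \<and> card B = k}"
    by (rule inj_on_inverseI[where g = "\<lambda>A. A - {i}"]) auto
  ultimately show ?thesis
    using assms by (simp add: fdeg_def card_image n_subsets)
qed

context
  fixes m n :: nat and \<F> :: "nat set set"
  assumes n: "n = 2 * m + 1"
    and sub: "\<And>A. A \<in> \<F> \<Longrightarrow> A \<subseteq> voters n \<and> card A = m"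
    and intersecting: "\<And>A B. A \<in> \<F> \<Longrightarrow> B \<in> \<F> \<Longrightarrow> A \<inter> B \<noteq> {}"
begin

lemma card_compl_voters: "A \<subseteq> voters n \<Longrightarrow> card (voters n - A) = n - card A"
  using finite_subset[OF _ finite_voters] by (subst card_Diff_subset) auto

text \<open>Complementation exchanges the sizes \<open>m\<close> and \<open>m + 1\<close>, and an
  intersecting family contains no complementary pair.\<close>

lemma perturbed_majority_odd: "odd_rule n (coalition_rule n (perturbed_majority m \<F>))"
proof (rule coalition_rule_odd)
  fix A assume A: "A \<subseteq> voters n"
  have c: "card A \<le> n" using card_mono[OF finite_voters A] by simp
  have AA: "voters n - (voters n - A) = A" using A by blast
  have "\<not> (A \<in> \<F> \<and> voters n - A \<in> \<F>)" using intersecting by blast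
  moreover have "card A = m" if "A \<in> \<F>" using sub that by blast
  moreover have "n - card A = m" if "voters n - A \<in> \<F>"
    using sub[OF that] card_compl_voters[OF A] by simp
  ultimately show "(voters n - A \<in> perturbed_majority m \<F>) \<longleftrightarrow> A \<notin> perturbed_majority m \<F>"
    using A c unfolding perturbed_majority_def n[symmetric]
    by (simp add: card_compl_voters AA) (use n in linarith)
qed

text \<open>The critical case is a member \<open>A\<close> of \<F> inside a set \<open>B\<close> of
  size \<open>m + 1\<close>. Here \<open>B\<close> wins because its complement is disjoint from
  \<open>A\<close> and so cannot lie in \<F>.\<close>

lemma perturbed_majority_up:
  assumes A: "A \<in> perturbed_majority m \<F>" and AB: "A \<subseteq> B" and B: "B \<subseteq> voters n"
  shows "B \<in> perturbed_majority m \<F>"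
proof (cases "A = B")
  case False
  have "finite B" using B finite_voters finite_subset by blast
  then have less: "card A < card B" using AB False psubset_card_mono by blast
  have "voters n - B \<notin> \<F>" if "A \<in> \<F>" using intersecting[OF that] AB by blast
  moreover have "card A = m" if "A \<in> \<F>" using sub that by blast
  ultimately show ?thesis
    using A B less unfolding perturbed_majority_def n[symmetric] by auto
qed (use A in simp)

text \<open>This recovers \<F> from the rule, so that automorphisms of the rule act on \<F>.\<close>

lemma perturbed_majority_level: "level (perturbed_majority m \<F>) m = \<F>"
  using sub unfolding level_def perturbed_majority_def n[symmetric] by auto

text \<open>Only level \<open>m + 1\<close> needs work: it is the full level without the complements
  of members of \<F>, and such a complement contains \<open>i\<close> exactly when the member avoids
  \<open>i\<close>.\<close>

lemma perturbed_majority_regular: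
  assumes reg: "regular_family (voters n) \<F>"
  shows "regular_family (voters n) (level (perturbed_majority m \<F>) k)"
proof -
  let ?W = "perturbed_majority m \<F>"
  let ?V = "voters n"
  let ?full = "\<lambda>k. {A. A \<subseteq> ?V \<and> card A = k}"
  have full: "regular_family ?V (?full (Suc k))" for k
    by (simp add: regular_family_def fdeg_all_subsets)
  consider "k < m" | "k = m" | "k = m + 1" | "k \<ge> m + 2" by linarith
  then show ?thesis
  proof cases
    case 1
    have "level ?W k = {}"
      using 1 sub unfolding level_def perturbed_majority_def n[symmetric] by fastforce
    then show ?thesis by (simp add: regular_family_def fdeg_def)
  next
    case 2
    then show ?thesis using reg perturbed_majority_level by simp
  next
    case 3
    have fin: "finite (?full l)" for l by simp
    have finF: "finite \<F>" using finite_subset[OF _ fin[of m]] sub by blast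
    have lev: "level ?W k = {A\<in>?full k. ?V - A \<notin> \<F>}"
      using 3 sub unfolding level_def perturbed_majority_def n[symmetric] by fastforce
    have deg: "fdeg (level ?W k) i + card \<F> = fdeg (?full k) i + fdeg \<F> i" if i: "i \<in> ?V" for i
    proof -
      have "fdeg (?full k) i = fdeg (level ?W k) i + card {A\<in>?full k. i \<in> A \<and> ?V - A \<in> \<F>}"
        unfolding fdeg_def lev
        by (subst card_Un_disjoint[symmetric]) (auto intro!: arg_cong[where f = card])
      moreover have "card {A\<in>?full k. i \<in> A \<and> ?V - A \<in> \<F>} = card {B\<in>\<F>. i \<notin> B}"
      proof (rule bij_betw_same_card[where f = "\<lambda>A. ?V - A"],
          rule bij_betw_byWitness[where f' = "\<lambda>A. ?V - A"])
        show "(\<lambda>A. ?V - A) ` {B\<in>\<F>. i \<notin> B} \<subseteq> {A\<in>?full k. i \<in> A \<and> ?V - A \<in> \<F>}"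
        proof (rule image_subsetI)
          fix B assume "B \<in> {B\<in>\<F>. i \<notin> B}"
          then have B: "B \<in> \<F>" "i \<notin> B" "B \<subseteq> ?V" "card B = m" using sub by auto
          then have "card (?V - B) = k" using card_compl_voters[OF B(3)] 3 n by simp
          then show "?V - B \<in> {A\<in>?full k. i \<in> A \<and> ?V - A \<in> \<F>}"
            using B i by (simp add: double_diff)
        qed
      qed (use sub in blast)+
      moreover have "card \<F> = fdeg \<F> i + card {B\<in>\<F>. i \<notin> B}"
        unfolding fdeg_def using finF
        by (subst card_Un_disjoint[symmetric]) (auto intro!: arg_cong[where f = card])
      ultimately show ?thesis by simp
    qed
    have regfull: "regular_family ?V (?full k)" using full[of m] 3 by simp
    show ?thesis
      unfolding regular_family_def
    proof (intro ballI)
      fix i j assume ij: "i \<in> ?V" "j \<in> ?V"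
      then have "fdeg \<F> i = fdeg \<F> j" "fdeg (?full k) i = fdeg (?full k) j"
        using reg regfull unfolding regular_family_def by blast+
      then show "fdeg (level ?W k) i = fdeg (level ?W k) j"
        using deg[OF ij(1)] deg[OF ij(2)] by simp
    qed
  next
    case 4
    then have "level ?W k = ?full k"
      unfolding level_def perturbed_majority_def n[symmetric] by auto
    then show ?thesis using full[of "k - 1"] 4 by simp
  qed
qed

lemma perturbed_majority_unbiased:
  assumes "regular_family (voters n) \<F>"
  shows "unbiased n (coalition_rule n (perturbed_majority m \<F>))"
  by (rule coalition_rule_unbiased)
     (use perturbed_majority_up perturbed_majority_regular[OF assms] n in
      \<open>auto simp: perturbed_majority_def\<close>)

text \<open>An automorphism preserves winning and cardinality, hence permutes level
  \<open>m\<close>, which is \<F>. Taking images then matches the members counted on both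
  sides.\<close>

lemma codeg_aut:
  assumes \<sigma>: "\<sigma> \<in> aut n (coalition_rule n (perturbed_majority m \<F>))"
  shows "codeg \<F> (\<sigma> u) (\<sigma> v) = codeg \<F> u v"
proof -
  have perm: "\<sigma> permutes voters n" using \<sigma> by (simp add: aut_def)
  have inj: "inj \<sigma>" using permutes_inj[OF perm] .
  have F: "\<sigma> ` A \<in> \<F> \<longleftrightarrow> A \<in> \<F>" if "A \<subseteq> voters n" for A
  proof -
    have "\<sigma> ` A \<in> level (perturbed_majority m \<F>) m \<longleftrightarrow> A \<in> level (perturbed_majority m \<F>) m"
      using aut_coalition_rule[OF \<sigma> that] card_image[OF inj_on_subset[OF inj subset_UNIV]]
      by (simp add: level_def)
    then show ?thesis by (simp add: perturbed_majority_level)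
  qed
  have "{A\<in>\<F>. \<sigma> u \<in> A \<and> \<sigma> v \<in> A} = (`) \<sigma> ` {A\<in>\<F>. u \<in> A \<and> v \<in> A}"
  proof (intro equalityI subsetI)
    fix B assume B: "B \<in> {A\<in>\<F>. \<sigma> u \<in> A \<and> \<sigma> v \<in> A}"
    have BA: "\<sigma> ` (\<sigma> -` B) = B" using permutes_surj[OF perm] by (rule surj_image_vimage_eq)
    moreover have "\<sigma> -` B \<subseteq> voters n"
      using sub B permutes_in_image[OF perm] by blast
    ultimately have "\<sigma> -` B \<in> \<F>" using F[of "\<sigma> -` B"] B by simp
    then have "\<sigma> -` B \<in> {A\<in>\<F>. u \<in> A \<and> v \<in> A}" using B by simp
    then show "B \<in> (`) \<sigma> ` {A\<in>\<F>. u \<in> A \<and> v \<in> A}" using BA by (metis image_eqI)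
  next
    fix B assume "B \<in> (`) \<sigma> ` {A\<in>\<F>. u \<in> A \<and> v \<in> A}"
    then show "B \<in> {A\<in>\<F>. \<sigma> u \<in> A \<and> \<sigma> v \<in> A}" using F sub by auto
  qed
  moreover have "inj_on ((`) \<sigma>) S" for S using inj by (simp add: inj_on_def inj_image_eq_iff)
  ultimately show ?thesis by (simp add: codeg_def card_image)
qed

text \<open>
  If the automorphism group were transitive, its translates of \<open>X\<close> would be the classes of the
  relation "equal or of codegree different from \<open>q\<close>" and hence partition the voters.
\<close>

lemma perturbed_majority_not_transitive:
  assumes X: "X \<subseteq> voters n" "X \<noteq> {}" and ndvd: "\<not> card X dvd n"
    and inside: "\<And>u v. u \<in> X \<Longrightarrow> v \<in> X \<Longrightarrow> u \<noteq> v \<Longrightarrow> codeg \<F> u v \<noteq> q"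
    and across: "\<And>u v. u \<in> X \<Longrightarrow> v \<in> voters n - X \<Longrightarrow> codeg \<F> u v = q"
  shows "\<not> transitive_symmetric n (coalition_rule n (perturbed_majority m \<F>))"
proof
  let ?G = "aut n (coalition_rule n (perturbed_majority m \<F>))"
  assume trans: "transitive_symmetric n (coalition_rule n (perturbed_majority m \<F>))"
  \<comment> \<open>The codegree of a voter with itself is its degree, about which nothing is
    assumed; the clause \<open>v = u\<close> puts each voter into its own class regardless.\<close>
  define R where "R u = {v\<in>voters n. v = u \<or> codeg \<F> u v \<noteq> q}" for u
  have RX: "R x = X" if "x \<in> X" for x using that X inside[OF that] across[OF that] by (auto simp: R_def)
  have R\<sigma>: "R (\<sigma> x) = \<sigma> ` X" if "\<sigma> \<in> ?G" "x \<in> X" for \<sigma> x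
  proof -
    have perm: "\<sigma> permutes voters n" using that(1) by (simp add: aut_def)
    have "\<sigma> v \<in> R (\<sigma> x) \<longleftrightarrow> v \<in> R x" for v
      using codeg_aut[OF that(1)] permutes_in_image[OF perm] permutes_inj[OF perm]
      by (simp add: R_def inj_eq)
    then have "\<sigma> -` R (\<sigma> x) = R x" by auto
    then have "R (\<sigma> x) = \<sigma> ` R x"
      using permutes_surj[OF perm] by (metis surj_image_vimage_eq)
    then show ?thesis using RX[OF that(2)] by simp
  qed
  obtain x0 where x0: "x0 \<in> X" using X(2) by blast
  \<comment> \<open>Transitivity moves \<open>x0\<close> to any given voter, so every class is a
    translate of \<open>X\<close>.\<close>
  have translate: "\<exists>\<sigma>\<in>?G. R v = \<sigma> ` X" if "v \<in> voters n" for v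
  proof -
    have "x0 \<in> voters n" using x0 X(1) by blast
    then have "\<exists>\<sigma>\<in>?G. \<sigma> x0 = v"
      using trans that unfolding transitive_symmetric_def by simp
    then show ?thesis using R\<sigma>[OF _ x0] by metis
  qed
  have "card X dvd card (\<Union> (R ` voters n))"
  proof (rule dvd_partition)
    have "\<Union> (R ` voters n) \<subseteq> voters n" by (auto simp: R_def)
    then show "finite (\<Union> (R ` voters n))" by (rule finite_subset) simp
    show "\<forall>c\<in>R ` voters n. card X dvd card c"
    proof
      fix c assume "c \<in> R ` voters n"
      then obtain \<sigma> where \<sigma>: "\<sigma> \<in> ?G" "c = \<sigma> ` X" using translate by blast
      then have inj: "inj \<sigma>" by (auto simp: aut_def intro: permutes_inj)
      show "card X dvd card c"
        using \<sigma>(2) card_image[OF inj_on_subset[OF inj subset_UNIV]] by simp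
    qed
    show "\<forall>c1\<in>R ` voters n. \<forall>c2\<in>R ` voters n. c1 \<noteq> c2 \<longrightarrow> c1 \<inter> c2 = {}"
    proof (intro ballI impI)
      fix c1 c2 assume c: "c1 \<in> R ` voters n" "c2 \<in> R ` voters n" "c1 \<noteq> c2"
      \<comment> \<open>A class is the class of each of its elements, so classes with a common
        element coincide.\<close>
      have "R w = c" if cw: "c \<in> R ` voters n" "w \<in> c" for c w
      proof -
        obtain \<sigma> where \<sigma>: "\<sigma> \<in> ?G" "c = \<sigma> ` X" using translate cw(1) by blast
        then obtain x where "x \<in> X" "w = \<sigma> x" using cw(2) by blast
        then show ?thesis using R\<sigma> \<sigma> by simp
      qed
      then show "c1 \<inter> c2 = {}" using c by blast
    qed
  qed
  moreover have "\<Union> (R ` voters n) = voters n" by (auto simp: R_def)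
  ultimately show False using ndvd by simp
qed

end

section \<open>A regular intersecting family\<close>

definition joined :: "'a set \<Rightarrow> 'a set set \<Rightarrow> 'a set set \<Rightarrow> 'a set set" where
  "joined X \<G> \<H> = (\<lambda>(x, B). insert x B) ` (X \<times> \<G>) \<union> (\<union>) X ` \<H>"

context
  fixes X Y :: "'a set" and \<G> \<H> :: "'a set set"
  assumes fin: "finite X" "finite Y" and disj: "X \<inter> Y = {}" and X2: "2 \<le> card X"
    and G: "\<And>B. B \<in> \<G> \<Longrightarrow> B \<subseteq> Y" and H: "\<And>C. C \<in> \<H> \<Longrightarrow> C \<subseteq> Y"
begin

text \<open>Members of the first kind meet \<open>X\<close> in one point, those of the second
  contain all of \<open>X\<close>, which has at least two points. As \<open>X\<close> and
  \<open>Y\<close> are disjoint, each member determines its parts. The predicate \<open>P\<close>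
  serves degrees and codegrees alike.\<close>

lemma card_joined:
  "card {A\<in>joined X \<G> \<H>. P A} =
    card {(x, B)\<in>X \<times> \<G>. P (insert x B)} + card {C\<in>\<H>. P (X \<union> C)}"
proof -
  let ?S = "{(x, B)\<in>X \<times> \<G>. P (insert x B)}" and ?T = "{C\<in>\<H>. P (X \<union> C)}"
  have finG: "finite \<G>" and finH: "finite \<H>"
    using G H fin(2) by (meson Pow_iff finite_Pow_iff finite_subset subsetI)+
  have "{A\<in>joined X \<G> \<H>. P A} = (\<lambda>(x, B). insert x B) ` ?S \<union> (\<union>) X ` ?T"
    by (auto simp: joined_def)
  moreover have "(\<lambda>(x, B). insert x B) ` ?S \<inter> (\<union>) X ` ?T = {}"
  proof -
    have "insert x B \<noteq> X \<union> C" if "x \<in> X" "B \<in> \<G>" "C \<in> \<H>" for x B C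
    proof
      assume "insert x B = X \<union> C"
      then have "X = {x}" using G[OF that(2)] disj that(1) by blast
      then show False using X2 by simp
    qed
    then show ?thesis by auto
  qed
  moreover have "finite ?S" by (rule finite_subset[of _ "X \<times> \<G>"]) (use fin(1) finG in auto)
  moreover have "finite ?T" using finH by simp
  moreover have "card ((\<lambda>(x, B). insert x B) ` ?S) = card ?S"
  proof (rule card_image, rule inj_onI, clarify)
    fix x B x' B'
    assume "x \<in> X" "x' \<in> X" "B \<in> \<G>" "B' \<in> \<G>" and eq: "insert x B = insert x' B'"
    then have *: "x \<notin> Y" "x' \<notin> Y" "B \<subseteq> Y" "B' \<subseteq> Y" using disj G by auto
    then have "x = x'" using eq by auto
    moreover have "B = B'" using eq * by auto
    ultimately show "x = x' \<and> B = B'" by simp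
  qed
  moreover have "card ((\<union>) X ` ?T) = card ?T"
  proof (rule card_image, rule inj_onI)
    fix C C' assume *: "C \<in> ?T" "C' \<in> ?T" "X \<union> C = X \<union> C'"
    then have "C \<subseteq> Y" "C' \<subseteq> Y" using H by auto
    then show "C = C'" using *(3) disj by blast
  qed
  ultimately show ?thesis by (simp add: card_Un_disjoint)
qed

lemma fdeg_joined_X:
  assumes x: "x \<in> X"
  shows "fdeg (joined X \<G> \<H>) x = card \<G> + card \<H>"
proof -
  have "{(z, B)\<in>X \<times> \<G>. x \<in> insert z B} = {x} \<times> \<G>" using x disj G by auto
  moreover have "{C\<in>\<H>. x \<in> X \<union> C} = \<H>" using x by auto
  ultimately show ?thesis by (simp add: fdeg_def card_joined card_cartesian_product)
qed

lemma fdeg_joined_Y: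
  assumes y: "y \<in> Y"
  shows "fdeg (joined X \<G> \<H>) y = card X * fdeg \<G> y + fdeg \<H> y"
proof -
  have "{(z, B)\<in>X \<times> \<G>. y \<in> insert z B} = X \<times> {B\<in>\<G>. y \<in> B}" using y disj by auto
  moreover have "{C\<in>\<H>. y \<in> X \<union> C} = {C\<in>\<H>. y \<in> C}" using y disj by auto
  ultimately show ?thesis by (simp add: fdeg_def card_joined card_cartesian_product)
qed

text \<open>Members built from \<G> meet \<open>X\<close> in a single point, so only those built
  from \<H> count.\<close>

lemma codeg_joined_XX:
  assumes "x \<in> X" "x' \<in> X" "x \<noteq> x'"
  shows "codeg (joined X \<G> \<H>) x x' = card \<H>"
proof -
  have "{(z, B)\<in>X \<times> \<G>. x \<in> insert z B \<and> x' \<in> insert z B} = {}" using assms disj G by blast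
  moreover have "{C\<in>\<H>. x \<in> X \<union> C \<and> x' \<in> X \<union> C} = \<H>" using assms by auto
  ultimately show ?thesis by (simp only: codeg_def card_joined) simp
qed

lemma codeg_joined_XY:
  assumes "x \<in> X" "y \<in> Y"
  shows "codeg (joined X \<G> \<H>) x y = fdeg \<G> y + fdeg \<H> y"
proof -
  have "{(z, B)\<in>X \<times> \<G>. x \<in> insert z B \<and> y \<in> insert z B} = {x} \<times> {B\<in>\<G>. y \<in> B}"
    using assms disj G by auto
  moreover have "{C\<in>\<H>. x \<in> X \<union> C \<and> y \<in> X \<union> C} = {C\<in>\<H>. y \<in> C}" using assms disj by auto
  ultimately show ?thesis by (simp only: codeg_def fdeg_def card_joined card_cartesian_product) simp
qed

text \<open>Two members of \<open>\<G>\<close> meet because each contains more than half of \<open>Y\<close>.\<close>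

lemma joined_intersecting:
  assumes big: "\<And>B. B \<in> \<G> \<Longrightarrow> card Y < 2 * card B"
    and A: "A \<in> joined X \<G> \<H>" "A' \<in> joined X \<G> \<H>"
  shows "A \<inter> A' \<noteq> {}"
proof -
  have "X \<noteq> {}" using X2 by auto
  have GG: "B \<inter> B' \<noteq> {}" if "B \<in> \<G>" "B' \<in> \<G>" for B B'
  proof
    assume "B \<inter> B' = {}"
    moreover have "finite B" "finite B'" using G that fin(2) finite_subset by blast+
    ultimately have "card B + card B' = card (B \<union> B')" by (simp add: card_Un_disjoint)
    also have "\<dots> \<le> card Y" using G that fin(2) by (intro card_mono) auto
    finally show False using big[OF that(1)] big[OF that(2)] by simp
  qed
  \<comment> \<open>Every member meets \<open>X\<close>, so a pair in which one member contains
    \<open>X\<close> meets inside \<open>X\<close>.\<close>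
  from A show ?thesis
    unfolding joined_def using \<open>X \<noteq> {}\<close> GG by (auto; blast)
qed

end

text \<open>Binomial coefficients increase up to the middle, which reduces the claim to
  \<open>k = 3\<close>. There \<open>(b - 1) * (b - 2)\<close> must reach
  \<open>6 * (b + 2)\<close>, that is, \<open>(b - 10) * (b + 1)\<close> must be
  nonnegative.\<close>

lemma cubic_binomial_bound:
  assumes "10 \<le> b" "3 \<le> k" "2 * k \<le> b" "t \<le> b + 2"
  shows "t * b \<le> b choose k"
proof -
  obtain c where b: "b = c + 10" using assms(1) le_Suc_ex by (metis add.commute)
  have "3 * (b choose 3) = b * (c + 9 choose 2)"
    using Suc_times_binomial[of 2 "c + 9"] by (simp add: b eval_nat_numeral del: binomial_Suc_Suc)
  moreover have "2 * (c + 9 choose 2) = (c + 9) * (c + 8)"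
    using Suc_times_binomial[of 1 "c + 8"] by (simp add: eval_nat_numeral add.commute del: binomial_Suc_Suc)
  ultimately have "6 * (b choose 3) = b * ((c + 9) * (c + 8))" by algebra
  then have "6 * ((b + 2) * b) \<le> 6 * (b choose 3)"
    by (simp add: b algebra_simps)
  moreover have "t * b \<le> (b + 2) * b" using assms(4) by (rule mult_le_mono1)
  moreover have "b choose 3 \<le> b choose k" using assms by (intro binomial_mono) auto
  ultimately show ?thesis by linarith
qed

text \<open>
  The sizes \<open>(m + 1) b\<close> and \<open>(2m - 1) b\<close>, where \<open>b = 2m - 3\<close> is the number of points outside \<open>X\<close>,
  are forced up to scaling by equating the degrees of points inside and outside \<open>X\<close>.
\<close>

lemma exists_intersecting_family:
  assumes m: "7 \<le> m" and n: "n = 2 * m + 1"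
  obtains \<F> X q where
    "\<And>A. A \<in> \<F> \<Longrightarrow> A \<subseteq> voters n \<and> card A = m"
    "\<And>A B. A \<in> \<F> \<Longrightarrow> B \<in> \<F> \<Longrightarrow> A \<inter> B \<noteq> {}"
    "regular_family (voters n) \<F>"
    "X \<subseteq> voters n" "card X = 4"
    "\<And>u v. u \<in> X \<Longrightarrow> v \<in> X \<Longrightarrow> u \<noteq> v \<Longrightarrow> codeg \<F> u v \<noteq> q"
    "\<And>u v. u \<in> X \<Longrightarrow> v \<in> voters n - X \<Longrightarrow> codeg \<F> u v = q"
proof -
  \<comment> \<open>Writing \<open>m\<close> as \<open>r + 7\<close> avoids subtraction. The sets in
    \<G> and \<H> have sizes \<open>m - 1 = r + 6\<close> and \<open>m - 4 = r + 3\<close>; the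
    latter is at least 3, as the binomial bound demands.\<close>
  obtain r where r: "m = r + 7" using m le_Suc_ex by (metis add.commute)
  define X Y where "X = {1..4::nat}" and "Y = {5..n}"
  have V: "voters n = X \<union> Y" using n m by (auto simp: X_def Y_def voters_def)
  have fin: "finite X" "finite Y" and disj: "X \<inter> Y = {}" and cX: "card X = 4"
    by (auto simp: X_def Y_def)
  have cY: "card Y = 2 * r + 11" by (simp add: Y_def n r)
  \<comment> \<open>Since \<open>r + 6\<close> lies just above half of
    \<open>card Y = 2 * r + 11\<close>, the bound is applied to the complementary size
    \<open>r + 5\<close>.\<close>
  have "(r + 8) * card Y \<le> card Y choose (r + 5)"
    by (rule cubic_binomial_bound) (simp_all add: cY)
  also have "\<dots> = card Y choose (r + 6)"
    using binomial_symmetric[of "r + 5" "card Y"] by (simp add: cY add.commute)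
  finally obtain \<G> where \<G>: "\<G> \<subseteq> {A. A \<subseteq> Y \<and> card A = r + 6}" "card \<G> = (r + 8) * card Y"
    "\<And>v. v \<in> Y \<Longrightarrow> fdeg \<G> v = (r + 6) * (r + 8)"
    using exists_regular_family[OF fin(2)] by blast
  have "(2 * r + 13) * card Y \<le> card Y choose (r + 3)"
    by (rule cubic_binomial_bound) (simp_all add: cY)
  then obtain \<H> where \<H>: "\<H> \<subseteq> {A. A \<subseteq> Y \<and> card A = r + 3}" "card \<H> = (2 * r + 13) * card Y"
    "\<And>v. v \<in> Y \<Longrightarrow> fdeg \<H> v = (r + 3) * (2 * r + 13)"
    using exists_regular_family[OF fin(2)] by blast
  have X2: "2 \<le> card X" and GY: "\<And>B. B \<in> \<G> \<Longrightarrow> B \<subseteq> Y" and HY: "\<And>C. C \<in> \<H> \<Longrightarrow> C \<subseteq> Y"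
    using cX \<G>(1) \<H>(1) by auto
  note join = fin disj X2 GY HY
  let ?F = "joined X \<G> \<H>"
  show thesis
  proof (rule that[of ?F X "(r + 6) * (r + 8) + (r + 3) * (2 * r + 13)"])
    show "A \<subseteq> voters n \<and> card A = m" if "A \<in> ?F" for A
    proof -
      consider x B where "A = insert x B" "x \<in> X" "B \<in> \<G>" | C where "A = X \<union> C" "C \<in> \<H>"
        using \<open>A \<in> ?F\<close> by (auto simp: joined_def)
      then show ?thesis
      proof cases
        case 1
        then have B: "B \<subseteq> Y" "card B = r + 6" using \<G>(1) by auto
        then have "x \<notin> B" "finite B" using 1(2) disj fin(2) finite_subset by auto
        then show ?thesis using 1 B V r by auto
      next
        case 2
        then have C: "C \<subseteq> Y" "card C = r + 3" using \<H>(1) by auto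
        then have "X \<inter> C = {}" "finite C" using disj fin(2) finite_subset by auto
        then show ?thesis using 2 C V r cX fin(1) by (auto simp: card_Un_disjoint)
      qed
    qed
    show "A \<inter> B \<noteq> {}" if "A \<in> ?F" "B \<in> ?F" for A B
      by (rule joined_intersecting[OF join _ that]) (use \<G>(1) cY in auto)
    \<comment> \<open>For families of sizes \<open>g * b\<close> and \<open>h * b\<close>, equal
      degrees mean \<open>b * (g + h) = 4 * (m - 1) * g + (m - 4) * h\<close>, that is,
      \<open>(m + 1) * h = (2 * m - 1) * g\<close>.\<close>
    have "fdeg ?F x = (r + 8) * (2 * r + 11) + (2 * r + 13) * (2 * r + 11)" if "x \<in> X" for x
      using fdeg_joined_X[OF join that] \<G>(2) \<H>(2) cY by simp
    moreover have "fdeg ?F y = (r + 8) * (2 * r + 11) + (2 * r + 13) * (2 * r + 11)" if "y \<in> Y" for y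
      using fdeg_joined_Y[OF join that] \<G>(3)[OF that] \<H>(3)[OF that] cX by (simp add: algebra_simps)
    ultimately show "regular_family (voters n) ?F"
      unfolding regular_family_def V by (metis Un_iff)
    show "X \<subseteq> voters n" using V by simp
    show "card X = 4" by (rule cX)
    \<comment> \<open>The codegree inside \<open>X\<close> exceeds the one across by
      \<open>(r + 7) * (r + 8)\<close>.\<close>
    show "codeg ?F u v \<noteq> (r + 6) * (r + 8) + (r + 3) * (2 * r + 13)"
      if "u \<in> X" "v \<in> X" "u \<noteq> v" for u v
      using codeg_joined_XX[OF join that] \<H>(2) cY by (simp add: algebra_simps)
    show "codeg ?F u v = (r + 6) * (r + 8) + (r + 3) * (2 * r + 13)"
      if "u \<in> X" "v \<in> voters n - X" for u v
      proof -
      have v: "v \<in> Y" using that(2) V by blast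
      show ?thesis using codeg_joined_XY[OF join that(1) v] \<G>(3)[OF v] \<H>(3)[OF v] by simp
    qed
  qed
qed

theorem theorem1:
  shows "\<exists>N::nat. \<forall>n\<ge>N. odd n \<longrightarrow>
    (\<exists>\<Phi>. voting_rule n \<Phi> \<and> odd_rule n \<Phi> \<and> monotone_rule n \<Phi> \<and> unbiased n \<Phi> \<and>
         \<not> transitive_symmetric n \<Phi>)"
\<comment> \<open>The bound 15 is \<open>2 * 7 + 1\<close>, from \<open>7 \<le> m\<close>.\<close>
proof (intro exI[of _ 15] allI impI)
  fix n :: nat assume "n \<ge> 15" "odd n"
  then obtain m where n: "n = 2 * m + 1" and m: "7 \<le> m" by (auto elim!: oddE)
  obtain \<F> X q where F: "\<And>A. A \<in> \<F> \<Longrightarrow> A \<subseteq> voters n \<and> card A = m"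
      "\<And>A B. A \<in> \<F> \<Longrightarrow> B \<in> \<F> \<Longrightarrow> A \<inter> B \<noteq> {}"
    and reg: "regular_family (voters n) \<F>"
    and X: "X \<subseteq> voters n" "card X = 4"
    and codeg: "\<And>u v. u \<in> X \<Longrightarrow> v \<in> X \<Longrightarrow> u \<noteq> v \<Longrightarrow> codeg \<F> u v \<noteq> q"
      "\<And>u v. u \<in> X \<Longrightarrow> v \<in> voters n - X \<Longrightarrow> codeg \<F> u v = q"
    using exists_intersecting_family[OF m n] by blast
  let ?\<Phi> = "coalition_rule n (perturbed_majority m \<F>)"
  have "X \<noteq> {}" using X(2) by auto
  moreover have "\<not> card X dvd n" unfolding X(2) n by presburger
  ultimately have "\<not> transitive_symmetric n ?\<Phi>"
    using perturbed_majority_not_transitive[OF n F X(1) _ _ codeg] by blast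
  moreover have "monotone_rule n ?\<Phi>"
    by (rule coalition_rule_monotone, rule perturbed_majority_up[OF n F])
  ultimately show "\<exists>\<Phi>. voting_rule n \<Phi> \<and> odd_rule n \<Phi> \<and> monotone_rule n \<Phi> \<and> unbiased n \<Phi> \<and>
      \<not> transitive_symmetric n \<Phi>"
    using coalition_rule_voting perturbed_majority_odd[OF n F]
      perturbed_majority_unbiased[OF n F reg] by blast
qed

end
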